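(* Let $2\le k_1<\dots<k_m\le n$ ($m\ge1$), $1\le i_{k_j}\le k_j-1$, with $M:=\sum_{j=1}^m i_{k_j}\le k_1$; let $\pi'=t_{k_1}^{i_{k_1}}\cdots t_{k_m}^{i_{k_m}}\in S_n$ and $\pi^\circ$ the same word in $D_n$. Let $L_1,\dots,L_u$ be pairwise distinct integers in $\{1,\dots,n-1\}$ and $\pi=w_{L_1}\cdot w_{L_2}\cdots w_{L_u}\cdot\pi^\circ$. For each $j$ define $$\varrho_{L_j}=\begin{cases} L_j & \text{if } L_j<M \text{ or } L_j\ge k_m,\\ L_j-M & \text{if } M\le L_j<k_1,\\ L_j-\sum_{x=q}^m i_{k_x} & \text{if } k_{q-1}\le L_j<k_q \text{ for some } 2\le q\le m.\end{cases}$$ Then $\ell(\pi)=\ell(\pi')+2\sum_{j=1}^u\varrho_{L_j}$.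
   Context: $D_n$ ($n\ge2$) is the Coxeter group with generators $s_{1'},s_1,\dots,s_{n-1}$ and relations $s^2=1$, $(s_i s_{i+1})^3=1$, $(s_is_j)^2=1$ for $|i-j|\ge 2$, $(s_{1'}s_2)^3=1$, $(s_{1'}s_i)^2=1$ for $i\ne 2$; $S_n$ has Coxeter generators $s_i=(i,i+1)$. In both groups $t_k=s_1\cdots s_{k-1}$; in $D_n$, $w_L=s_L s_{L-1}\cdots s_2 s_1 s_{1'} s_2\cdots s_L$. $\ell$ is Coxeter length in $D_n$ (generators $s_{1'},s_1,\dots,s_{n-1}$), resp. in $S_n$ for $\ell(\pi')$. (The hypothesis $M\le k_1$ says $\pi'$ is a standard OGS elementary element with major index $M$.) *)

theory Defs
  imports Main
begin

section \<open>The Coxeter group D_n, modelled by signed permutations of {+-1..+-n}\<close>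

text \<open>Generator labels: 0 stands for s_{1'}, and a >= 1 stands for s_a.
  s_{1'} acts as (1,-2)(2,-1); s_a acts as (a,a+1)(-a,-(a+1)).
  These satisfy exactly the Coxeter relations of type D_n (standard realisation).\<close>

definition sD :: "nat \<Rightarrow> int \<Rightarrow> int" where
  "sD a x =
    (if a = 0 then
       (if x = 1 then -2 else if x = 2 then -1 else if x = -1 then 2 else if x = -2 then 1 else x)
     else
       (if x = int a then int a + 1 else if x = int a + 1 then int a
        else if x = - int a then - int a - 1 else if x = - int a - 1 then - int a else x))"

definition gensD :: "nat \<Rightarrow> nat set" where
  "gensD n = {0..<n}"

definition evalD :: "nat list \<Rightarrow> (int \<Rightarrow> int)" where
  "evalD ws = foldr (\<lambda>a f. sD a \<circ> f) ws id"

definition lenD :: "nat \<Rightarrow> (int \<Rightarrow> int) \<Rightarrow> nat" where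
  "lenD n g = (LEAST k. \<exists>ws. set ws \<subseteq> gensD n \<and> length ws = k \<and> evalD ws = g)"

definition sS :: "nat \<Rightarrow> nat \<Rightarrow> nat" where
  "sS a x = (if x = a then a + 1 else if x = a + 1 then a else x)"

definition gensS :: "nat \<Rightarrow> nat set" where
  "gensS n = {1..<n}"

definition evalS :: "nat list \<Rightarrow> (nat \<Rightarrow> nat)" where
  "evalS ws = foldr (\<lambda>a f. sS a \<circ> f) ws id"

definition lenS :: "nat \<Rightarrow> (nat \<Rightarrow> nat) \<Rightarrow> nat" where
  "lenS n g = (LEAST k. \<exists>ws. set ws \<subseteq> gensS n \<and> length ws = k \<and> evalS ws = g)"

definition t_word :: "nat \<Rightarrow> nat list" where
  "t_word k = [1..<k]"

definition elem_word :: "nat \<Rightarrow> (nat \<Rightarrow> nat) \<Rightarrow> (nat \<Rightarrow> nat) \<Rightarrow> nat list" where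
  "elem_word m k i = concat (map (\<lambda>j. concat (replicate (i j) (t_word (k j)))) [1..<m+1])"

definition w_word :: "nat \<Rightarrow> nat list" where
  "w_word L = rev [1..<L+1] @ [0] @ [2..<L+1]"

definition ws_word :: "nat \<Rightarrow> (nat \<Rightarrow> nat) \<Rightarrow> nat list" where
  "ws_word u L = concat (map (\<lambda>j. w_word (L j)) [1..<u+1])"

definition rho :: "nat \<Rightarrow> (nat \<Rightarrow> nat) \<Rightarrow> (nat \<Rightarrow> nat) \<Rightarrow> nat \<Rightarrow> int" where
  "rho m k i x =
    (let M = (\<Sum>j=1..m. i j) in
     if x < M \<or> x \<ge> k m then int x
     else if M \<le> x \<and> x < k 1 then int x - int M
     else (let q = (THE q. 2 \<le> q \<and> q \<le> m \<and> k (q - 1) \<le> x \<and> x < k q)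
           in int x - int (\<Sum>y=q..m. i y)))"

end

(* The Coxeter length of a signed permutation g in D_n is the number of pairs i < j with
   g(i) > g(j) plus the number with g(i) + g(j) < 0; for S_n only the first count survives.
   The element w_L changes the sign of the values 1 and L+1. Hence negating the values
   L_1 + 1, ..., L_u + 1 of pi' adds 2 for each non-inversion of pi' whose larger value is
   some L_j + 1, and rho counts these non-inversions for L_j: they are read off the explicit
   inverse of pi', which is increasing on {1..M} and on {M+1..n}. *)

theory Submission
  imports Defs
begin

section \<open>Signed permutations and their words\<close>

lemma evalD_Nil [simp]: "evalD [] = id"
  by (simp add: evalD_def)

lemma evalD_Cons [simp]: "evalD (a # ws) = sD a \<circ> evalD ws"
  by (simp add: evalD_def)

lemma evalD_append [simp]: "evalD (vs @ ws) = evalD vs \<circ> evalD ws"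
  by (induction vs) (auto simp: o_assoc)

lemma evalS_Nil [simp]: "evalS [] = id"
  by (simp add: evalS_def)

lemma evalS_Cons [simp]: "evalS (a # ws) = sS a \<circ> evalS ws"
  by (simp add: evalS_def)

lemma evalS_append [simp]: "evalS (vs @ ws) = evalS vs \<circ> evalS ws"
  by (induction vs) (auto simp: o_assoc)

lemma sD_sD [simp]: "sD a (sD a x) = x"
  by (auto simp: sD_def)

lemma sD_minus: "sD a (- x) = - sD a x"
  by (auto simp: sD_def)

lemma sD_abs_le: "\<bar>x\<bar> \<le> int n \<Longrightarrow> a < n \<Longrightarrow> 2 \<le> n \<Longrightarrow> \<bar>sD a x\<bar> \<le> int n"
  by (auto simp: sD_def)

lemma sD_outside: "\<bar>x\<bar> > int n \<Longrightarrow> a < n \<Longrightarrow> 2 \<le> n \<Longrightarrow> sD a x = x"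
  by (auto simp: sD_def)

lemma sS_sS [simp]: "sS a (sS a x) = x"
  by (auto simp: sS_def)

lemma sD_int: "1 \<le> a \<Longrightarrow> sD a (int x) = int (sS a x)"
  by (auto simp: sD_def sS_def)

lemma evalD_int: "set ws \<subseteq> {1..} \<Longrightarrow> evalD ws (int x) = int (evalS ws x)"
  by (induction ws) (auto simp: sD_int)

lemma evalS_rev [simp]: "evalS (rev ws) (evalS ws x) = x"
  by (induction ws arbitrary: x) auto

lemma evalS_rev' [simp]: "evalS ws (evalS (rev ws) x) = x"
  using evalS_rev[of "rev ws" x] by simp

text \<open>This is the hyperoctahedral group, of type B_n: the parity of the sign changes, which
  singles out D_n, comes back in \<open>prod_sgn_evalD\<close>. Fixing all points beyond
  \<open>n\<close> makes equality of functions the equality of group elements.\<close>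

definition signed_perm :: "nat \<Rightarrow> (int \<Rightarrow> int) \<Rightarrow> bool" where
  "signed_perm n g \<longleftrightarrow> inj g \<and> (\<forall>x. g (- x) = - g x) \<and> (\<forall>x. \<bar>x\<bar> \<le> int n \<longrightarrow> \<bar>g x\<bar> \<le> int n)
     \<and> (\<forall>x. \<bar>x\<bar> > int n \<longrightarrow> g x = x)"

lemma signed_perm_evalD:
  assumes "set ws \<subseteq> {..<n}" "2 \<le> n"
  shows "signed_perm n (evalD ws)"
  using assms
proof (induction ws)
  case (Cons a ws)
  have "inj (sD a)" by (metis injI sD_sD)
  with Cons have "inj (evalD (a # ws))"
    unfolding evalD_Cons by (intro inj_compose) (auto simp: signed_perm_def)
  with Cons show ?case
    by (auto simp: signed_perm_def sD_minus sD_abs_le sD_outside comp_def)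
qed (auto simp: signed_perm_def)

lemma signed_perm_0: "signed_perm n g \<Longrightarrow> g 0 = 0"
  unfolding signed_perm_def by (metis equal_neg_zero neg_equal_zero add.inverse_neutral)

lemma signed_perm_eq_0_iff: "signed_perm n g \<Longrightarrow> g x = 0 \<longleftrightarrow> x = 0"
  by (metis signed_perm_0 signed_perm_def injD)

section \<open>The length function\<close>

text \<open>The two terms record the roots \<open>e\<^sub>j - e\<^sub>i\<close> and \<open>e\<^sub>j + e\<^sub>i\<close>. Their sum is even in the
  first argument, so a sign change there can be ignored.\<close>

definition pairwt :: "int \<Rightarrow> int \<Rightarrow> int" where
  "pairwt a b = of_bool (b < a) + of_bool (b < - a)"

lemma pairwt_minus [simp]: "pairwt (- a) b = pairwt a b"
  by (simp add: pairwt_def)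

definition pairs :: "nat \<Rightarrow> (int \<times> int) set" where
  "pairs n = {(i, j). 1 \<le> i \<and> i < j \<and> j \<le> int n}"

lemma finite_pairs [simp]: "finite (pairs n)"
  by (rule finite_subset[of _ "{1..int n} \<times> {1..int n}"]) (auto simp: pairs_def)

definition dinv :: "nat \<Rightarrow> (int \<Rightarrow> int) \<Rightarrow> int" where
  "dinv n g = (\<Sum>(i, j)\<in>pairs n. pairwt (g i) (g j))"

text \<open>An ascent is a simple root that \<open>g\<close> keeps positive. For
  \<open>a = 0\<close> the root is e_1 + e_2, so the test is on the sign of
  \<open>g 1 + g 2\<close>.\<close>

definition ascent :: "(int \<Rightarrow> int) \<Rightarrow> nat \<Rightarrow> bool" where
  "ascent g a \<longleftrightarrow> (if a = 0 then - g 1 < g 2 else g (int a) < g (int a + 1))"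

lemma dinv_nonneg: "0 \<le> dinv n g"
  unfolding dinv_def by (rule sum_nonneg) (auto simp: pairwt_def)

lemma dinv_id [simp]: "dinv n id = 0"
  unfolding dinv_def by (rule sum.neutral) (auto simp: pairwt_def pairs_def)

text \<open>Multiplying on the right by a generator permutes all pairs but one without changing
  their total weight, and changes the weight of the remaining pair by 1.\<close>

lemma dinv_sD:
  assumes g: "signed_perm n g" and a: "a < n" and n: "2 \<le> n"
  shows "dinv n (g \<circ> sD a) = dinv n g + (if ascent g a then 1 else - 1)"
proof -
  \<comment> \<open>Up to sign s_{1'} acts on 1 and 2 as s_1 does, so for \<open>a = 0\<close> the
    exceptional pair is (1, 2) too.\<close>
  define b where "b = (if a = 0 then 1 else a)"
  define e where "e = (int b, int b + 1)"
  have b: "1 \<le> b" "b < n" using a n by (auto simp: b_def)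
  have odd: "g (- x) = - g x" for x using g by (simp add: signed_perm_def)
  have inj: "g x = g y \<longleftrightarrow> x = y" for x y using g by (auto simp: signed_perm_def dest: injD)
  have e: "e \<in> pairs n" using b by (auto simp: e_def pairs_def)
  have split: "dinv n h = pairwt (h (int b)) (h (int b + 1)) + (\<Sum>(i,j)\<in>pairs n - {e}. pairwt (h i) (h j))" for h
    unfolding dinv_def using sum.remove[OF finite_pairs e, of "\<lambda>(i,j). pairwt (h i) (h j)"] by (simp add: e_def)
  have "(\<Sum>(i,j)\<in>pairs n - {e}. pairwt ((g \<circ> sD a) i) ((g \<circ> sD a) j))
      = (\<Sum>(i,j)\<in>pairs n - {e}. pairwt (g (sD b i)) (g (sD b j)))"
  proof (rule sum.cong[OF refl], unfold split_paired_all prod.case)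
    fix i j assume ij: "(i, j) \<in> pairs n - {e}"
    show "pairwt ((g \<circ> sD a) i) ((g \<circ> sD a) j) = pairwt (g (sD b i)) (g (sD b j))"
    proof (cases "a = 0")
      case True
      \<comment> \<open>For \<open>a = 0\<close>, a pair other than (1, 2) has its larger entry at
        least 3, hence fixed. Only the first argument of \<open>pairwt\<close> can differ in sign
        from its value under \<open>sD b\<close>, which \<open>pairwt\<close> ignores.\<close>
      then have j: "sD a j = sD b j" using ij by (auto simp: pairs_def e_def b_def sD_def)
      have "sD a i = - sD b i \<or> sD a i = sD b i"
        using ij True by (auto simp: pairs_def e_def b_def sD_def)
      then show ?thesis using j by (auto simp: odd)
    qed (simp add: b_def)
  qed
  moreover have closed: "(sD b i, sD b j) \<in> pairs n - {e}" if "(i, j) \<in> pairs n - {e}" for i j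
    using that b by (auto simp: pairs_def e_def sD_def split: if_splits)
  moreover have "(\<Sum>(i,j)\<in>pairs n - {e}. pairwt (g (sD b i)) (g (sD b j)))
      = (\<Sum>(i,j)\<in>pairs n - {e}. pairwt (g i) (g j))"
    by (rule sum.reindex_bij_witness[of _ "map_prod (sD b) (sD b)" "map_prod (sD b) (sD b)"])
       (simp_all add: closed split_paired_all del: Diff_iff)
  ultimately have rest: "(\<Sum>(i,j)\<in>pairs n - {e}. pairwt ((g \<circ> sD a) i) ((g \<circ> sD a) j))
      = (\<Sum>(i,j)\<in>pairs n - {e}. pairwt (g i) (g j))" by (simp only:)
  \<comment> \<open>On the exceptional pair exactly one term of \<open>pairwt\<close> flips: the one
    for the sum if \<open>a = 0\<close>, the one for the difference otherwise.\<close>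
  have "pairwt ((g \<circ> sD a) (int b)) ((g \<circ> sD a) (int b + 1))
      = pairwt (g (int b)) (g (int b + 1)) + (if ascent g a then 1 else - 1)"
  proof (cases "a = 0")
    case True
    have "sD a 1 = - 2" "sD a 2 = - 1" using True by (auto simp: sD_def)
    moreover have "g 2 \<noteq> - g 1" using inj[of 2 "-1"] by (simp add: odd)
    ultimately show ?thesis using True odd[of 1] odd[of 2]
      by (auto simp: pairwt_def ascent_def b_def)
  next
    case False
    have "sD a (int a) = int a + 1" "sD a (int a + 1) = int a" using False by (auto simp: sD_def)
    moreover have "g (int a + 1) \<noteq> g (int a)" using inj by simp
    ultimately show ?thesis using False
      by (auto simp: pairwt_def ascent_def b_def)
  qed
  then show ?thesis using split[of g] split[of "g \<circ> sD a"] rest by simp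
qed

section \<open>Word length and reduced words\<close>

lemma dinv_evalD_le_length:
  assumes "set ws \<subseteq> {..<n}" "2 \<le> n"
  shows "dinv n (evalD ws) \<le> int (length ws)"
  using assms
proof (induction ws rule: rev_induct)
  case (snoc a ws)
  then show ?case
    using dinv_sD[OF signed_perm_evalD, of ws n a] by (simp add: comp_def split: if_splits)
qed simp

text \<open>The elements of \<open>D\<^sub>n\<close> have an even number of sign changes.\<close>

lemma prod_sgn_evalD:
  assumes "set ws \<subseteq> {..<n}" "2 \<le> n"
  shows "(\<Prod>x\<in>{1..int n}. sgn (evalD ws x)) = 1"
  using assms
proof (induction ws rule: rev_induct)
  case (snoc a ws)
  define g where "g = evalD ws"
  have odd: "g (- x) = - g x" for x
    using signed_perm_evalD[of ws n] snoc.prems by (simp add: signed_perm_def g_def)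
  have IH: "(\<Prod>x\<in>{1..int n}. sgn (g x)) = 1" using snoc by (simp add: g_def)
  have "(\<Prod>x\<in>{1..int n}. sgn (g (sD a x))) = (\<Prod>x\<in>{1..int n}. sgn (g x))"
  proof (cases "a = 0")
    case True
    have split: "{1..int n} = {1, 2} \<union> {3..int n}" using snoc.prems by auto
    have "(\<Prod>x\<in>{3..int n}. sgn (g (sD a x))) = (\<Prod>x\<in>{3..int n}. sgn (g x))"
      by (rule prod.cong) (auto simp: True sD_def)
    moreover have "sD a 1 = - 2" "sD a 2 = - 1" using True by (auto simp: sD_def)
    ultimately show ?thesis unfolding split
      by (subst (1 2) prod.union_disjoint) (auto simp: odd[of 1] odd[of 2] sgn_minus)
  next
    case False
    show ?thesis
      by (rule prod.reindex_bij_witness[of _ "sD a" "sD a"])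
         (use False snoc.prems in \<open>auto simp: sD_def\<close>)
  qed
  then show ?case using IH by (simp add: g_def)
qed simp

text \<open>The values at 1, ..., n are increasing integers between 1 and n. Climbing from 1 gives
  \<open>g a\<close> at least \<open>a\<close>; descending from n gives at most
  \<open>a\<close>.\<close>

lemma signed_perm_no_descent:
  assumes g: "signed_perm n g" and pos: "0 < g 1"
    and asc: "\<And>a. 1 \<le> a \<Longrightarrow> a < n \<Longrightarrow> ascent g a"
  shows "g = id"
proof -
  have step: "g (int a) + 1 \<le> g (int a + 1)" if "1 \<le> a" "a < n" for a
    using asc[OF that] that by (auto simp: ascent_def)
  have lower: "int a \<le> g (int a)" if "1 \<le> a" "a \<le> n" for a
    using that
  proof (induction a rule: nat_induct_at_least)
    case base
    then show ?case using pos by simp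
  next
    case (Suc a)
    then show ?case using step[of a] by (simp add: add.commute)
  qed
  have upper: "g (int (n - d)) \<le> int (n - d)" if "d < n" for d
    using that
  proof (induction d)
    case 0
    have "\<bar>g (int n)\<bar> \<le> int n" using g by (auto simp: signed_perm_def)
    then show ?case by simp
  next
    case (Suc d)
    have "int (n - Suc d) + 1 = int (n - d)" using Suc.prems by simp
    then show ?case using step[of "n - Suc d"] Suc by (simp add: Suc_le_eq)
  qed
  have nat: "g (int a) = int a" for a
  proof (cases "1 \<le> a \<and> a \<le> n")
    case True
    then show ?thesis using lower[of a] upper[of "n - a"] by simp
  next
    case False
    then show ?thesis using g signed_perm_0[OF g] by (cases "a = 0") (auto simp: signed_perm_def)
  qed
  have "g x = x" for x
  proof (cases "0 \<le> x")
    case True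
    then show ?thesis using nat[of "nat x"] by simp
  next
    case False
    then show ?thesis using nat[of "nat (- x)"] g by (simp add: signed_perm_def)
  qed
  then show ?thesis by auto
qed

text \<open>The parameter \<open>c\<close> treats D_n (\<open>c = 0\<close>) and S_n
  (\<open>c = 1\<close>) together. For \<open>c = 1\<close> no value at a natural number is
  negative. For \<open>c = 0\<close> the ascents at 0 and 1 give |g 1| < g 2, so only
  \<open>g 1\<close> could be negative, and the even number of sign changes rules this out.\<close>

lemma evalD_no_descent:
  assumes ws: "set ws \<subseteq> {c..<n}" and n: "2 \<le> n" and c: "c \<le> 1"
    and asc: "\<And>a. c \<le> a \<Longrightarrow> a < n \<Longrightarrow> ascent (evalD ws) a"
  shows "evalD ws = id"
proof -
  define g where "g = evalD ws"
  have ws': "set ws \<subseteq> {..<n}" using ws by auto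
  have g: "signed_perm n g" unfolding g_def by (rule signed_perm_evalD[OF ws' n])
  have "0 < g 1"
  proof (cases "c = 0")
    case False
    then have "set ws \<subseteq> {1..}" using ws c by auto
    then have "g 1 \<ge> 0" using evalD_int[of ws 1] by (simp add: g_def)
    then show ?thesis using signed_perm_eq_0_iff[OF g, of 1] by simp
  next
    case True
    have step: "g (int a) < g (int a + 1)" if "1 \<le> a" "a < n" for a
      using asc[of a] that c by (simp add: ascent_def g_def)
    have "- g 1 < g 2" using asc[of 0] True n by (simp add: ascent_def g_def)
    moreover have "g 1 < g 2" using step[of 1] n by simp
    ultimately have g2: "0 < g 2" by simp
    have gpos: "0 < g (int a)" if "2 \<le> a" "a \<le> n" for a
      using that
    proof (induction a rule: nat_induct_at_least)
      case base
      then show ?case using g2 by simp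
    next
      case (Suc a)
      then show ?case using step[of a] by (simp add: add.commute)
    qed
    have "sgn (g x) = 1" if "x \<in> {2..int n}" for x
      using gpos[of "nat x"] that by (simp add: nat_le_iff le_nat_iff)
    then have "(\<Prod>x\<in>{2..int n}. sgn (g x)) = 1" by simp
    moreover have "{1..int n} = insert 1 {2..int n}" using n by auto
    ultimately have "sgn (g 1) = 1"
      using prod_sgn_evalD[OF ws' n] by (simp add: g_def)
    then show ?thesis by (simp add: sgn_1_pos)
  qed
  moreover have "ascent g a" if "1 \<le> a" "a < n" for a
    using asc[of a] that c by (simp add: g_def)
  ultimately show ?thesis using signed_perm_no_descent[OF g] by (simp add: g_def)
qed

text \<open>Appending a descent lowers \<open>dinv\<close> by one, so repeated descents reach the
  identity; the letters used stay in the range starting at \<open>c\<close>.\<close>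

lemma evalD_reduced_word:
  assumes "set ws \<subseteq> {c..<n}" and n: "2 \<le> n" and c: "c \<le> 1"
  shows "\<exists>vs. set vs \<subseteq> {c..<n} \<and> int (length vs) = dinv n (evalD ws) \<and> evalD vs = evalD ws"
  using assms(1)
proof (induction "nat (dinv n (evalD ws))" arbitrary: ws rule: less_induct)
  case less
  show ?case
  proof (cases "\<exists>a. c \<le> a \<and> a < n \<and> \<not> ascent (evalD ws) a")
    case False
    then have "evalD ws = id" using evalD_no_descent[OF less.prems n c] by blast
    then show ?thesis by (intro exI[of _ "[]"]) simp
  next
    case True
    then obtain a where a: "c \<le> a" "a < n" "\<not> ascent (evalD ws) a" by blast
    have "set ws \<subseteq> {..<n}" using less.prems by auto
    then have d: "dinv n (evalD (ws @ [a])) = dinv n (evalD ws) - 1"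
      using dinv_sD[OF signed_perm_evalD a(2) n] n a by simp
    with dinv_nonneg[of n "evalD (ws @ [a])"]
    have "nat (dinv n (evalD (ws @ [a]))) < nat (dinv n (evalD ws))" by linarith
    moreover have "set (ws @ [a]) \<subseteq> {c..<n}" using less.prems a by auto
    ultimately obtain vs where vs: "set vs \<subseteq> {c..<n}"
        "int (length vs) = dinv n (evalD (ws @ [a]))" "evalD vs = evalD (ws @ [a])"
      using less.hyps by blast
    have "evalD (vs @ [a]) = evalD ws" using vs(3) by (auto simp: fun_eq_iff)
    then show ?thesis using vs a d by (intro exI[of _ "vs @ [a]"]) auto
  qed
qed

text \<open>For \<open>c = 0\<close> the minimum is the length in D_n and for \<open>c = 1\<close>
  the length in S_n, so \<open>dinv\<close> measures both.\<close>

lemma Least_evalD_length: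
  assumes "set ws \<subseteq> {c..<n}" and n: "2 \<le> n" and c: "c \<le> 1"
  shows "int (LEAST k. \<exists>vs. set vs \<subseteq> {c..<n} \<and> length vs = k \<and> evalD vs = evalD ws)
    = dinv n (evalD ws)"
proof -
  obtain vs where vs: "set vs \<subseteq> {c..<n}" "int (length vs) = dinv n (evalD ws)" "evalD vs = evalD ws"
    using evalD_reduced_word[OF assms] by blast
  have "(LEAST k. \<exists>vs. set vs \<subseteq> {c..<n} \<and> length vs = k \<and> evalD vs = evalD ws) = length vs"
  proof (rule Least_equality)
    fix k assume "\<exists>us. set us \<subseteq> {c..<n} \<and> length us = k \<and> evalD us = evalD ws"
    then obtain us where us: "set us \<subseteq> {c..<n}" "length us = k" "evalD us = evalD ws" by blast
    then have "set us \<subseteq> {..<n}" by auto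
    then show "length vs \<le> k" using dinv_evalD_le_length[of us n] n us vs by simp
  qed (use vs in blast)
  then show ?thesis using vs by simp
qed

lemma lenD_evalD:
  assumes "set ws \<subseteq> {..<n}" "2 \<le> n"
  shows "int (lenD n (evalD ws)) = dinv n (evalD ws)"
  using Least_evalD_length[of ws 0 n] assms
  by (simp add: lenD_def gensD_def lessThan_atLeast0)

text \<open>S_n embeds in D_n: signed permutations are odd, so a word without s_{1'} is determined
  by its action on the natural numbers. The length in S_n can therefore be computed with
  \<open>evalD\<close>.\<close>

lemma evalS_eq_iff_evalD_eq:
  assumes "set vs \<subseteq> {1..<n}" "set ws \<subseteq> {1..<n}" "2 \<le> n"
  shows "evalS vs = evalS ws \<longleftrightarrow> evalD vs = evalD ws"
proof -
  have "set vs \<subseteq> {1..}" "set ws \<subseteq> {1..}" using assms by auto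
  note int = this[THEN evalD_int]
  have "set vs \<subseteq> {..<n}" "set ws \<subseteq> {..<n}" using assms by auto
  then have odd: "evalD vs (- x) = - evalD vs x" "evalD ws (- x) = - evalD ws x" for x
    using signed_perm_evalD assms(3) by (auto simp: signed_perm_def)
  show ?thesis
  proof
    assume "evalS vs = evalS ws"
    then have nat: "evalD vs (int x) = evalD ws (int x)" for x by (simp add: int)
    have "evalD vs x = evalD ws x" for x
      using nat odd by (cases x rule: int_cases2) auto
    then show "evalD vs = evalD ws" by auto
  next
    assume "evalD vs = evalD ws"
    then have "int (evalS vs x) = int (evalS ws x)" for x by (simp flip: int)
    then show "evalS vs = evalS ws" by auto
  qed
qed

lemma lenS_evalS:
  assumes ws: "set ws \<subseteq> {1..<n}" and n: "2 \<le> n"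
  shows "int (lenS n (evalS ws)) = dinv n (evalD ws)"
proof -
  have "(set vs \<subseteq> {1..<n} \<and> length vs = k \<and> evalS vs = evalS ws) \<longleftrightarrow>
      (set vs \<subseteq> {1..<n} \<and> length vs = k \<and> evalD vs = evalD ws)" for vs k
    using evalS_eq_iff_evalD_eq[OF _ ws n] by blast
  then show ?thesis
    using Least_evalD_length[OF ws n] by (simp add: lenS_def gensS_def)
qed

section \<open>The sign changes\<close>

lemma w_word_Suc: "1 \<le> L \<Longrightarrow> w_word (Suc L) = Suc L # w_word L @ [Suc L]"
  by (simp add: w_word_def)

text \<open>The element w_1 = s_1 s_{1'} negates 1 and 2. Conjugating w_L by s_{L+1} fixes 1 and
  moves the other negated point from L+1 to L+2.\<close>

lemma evalD_w_word:
  "1 \<le> L \<Longrightarrow> evalD (w_word L) x = (if \<bar>x\<bar> = 1 \<or> \<bar>x\<bar> = int L + 1 then - x else x)"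
proof (induction L arbitrary: x rule: nat_induct_at_least)
  case base
  have "w_word 1 = [1, 0]" by (simp add: w_word_def)
  then show ?case by (auto simp: sD_def)
next
  case (Suc L)
  show ?case using Suc.hyps by (auto simp: w_word_Suc Suc.IH sD_def)
qed

lemma ws_word_Suc: "ws_word (Suc u) L = ws_word u L @ w_word (L (Suc u))"
  by (simp add: ws_word_def)

text \<open>Since the L_j are distinct, each absolute value from 2 on is negated at most once. The
  sign of 1 depends on the parity of \<open>u\<close>; its absolute value is all that the weights
  need.\<close>

lemma evalD_ws_word:
  assumes "inj_on L {1..u}" "\<And>j. 1 \<le> j \<Longrightarrow> j \<le> u \<Longrightarrow> 1 \<le> L j"
  shows "\<bar>x\<bar> = 1 \<Longrightarrow> \<bar>evalD (ws_word u L) x\<bar> = 1"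
    and "2 \<le> \<bar>x\<bar> \<Longrightarrow> evalD (ws_word u L) x = (if \<exists>j\<in>{1..u}. \<bar>x\<bar> = int (L j) + 1 then - x else x)"
proof -
  have "(\<bar>x\<bar> = 1 \<longrightarrow> \<bar>evalD (ws_word u L) x\<bar> = 1) \<and>
    (2 \<le> \<bar>x\<bar> \<longrightarrow> evalD (ws_word u L) x = (if \<exists>j\<in>{1..u}. \<bar>x\<bar> = int (L j) + 1 then - x else x))"
    using assms
  proof (induction u arbitrary: x)
    case 0
    then show ?case by (simp add: ws_word_def)
  next
    case (Suc u)
    have inj: "inj_on L {1..u}" using Suc.prems(1) by (rule inj_on_subset) auto
    have new: "L j \<noteq> L (Suc u)" if "j \<in> {1..u}" for j
      using inj_onD[OF Suc.prems(1), of j "Suc u"] that by auto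
    have IH: "(\<bar>y\<bar> = 1 \<longrightarrow> \<bar>evalD (ws_word u L) y\<bar> = 1) \<and>
      (2 \<le> \<bar>y\<bar> \<longrightarrow> evalD (ws_word u L) y = (if \<exists>j\<in>{1..u}. \<bar>y\<bar> = int (L j) + 1 then - y else y))" for y
      using Suc.IH[OF inj] Suc.prems(2) by simp
    have w: "evalD (w_word (L (Suc u))) x = (if \<bar>x\<bar> = 1 \<or> \<bar>x\<bar> = int (L (Suc u)) + 1 then - x else x)"
      using Suc.prems(2)[of "Suc u"] by (simp add: evalD_w_word)
    have set: "{1..Suc u} = insert (Suc u) {1..u}" by auto
    show ?case
    proof (cases "\<bar>x\<bar> = int (L (Suc u)) + 1")
      case True
      then have "\<not> (\<exists>j\<in>{1..u}. \<bar>x\<bar> = int (L j) + 1)" using new by force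
      then show ?thesis
        unfolding ws_word_Suc evalD_append comp_apply w set using IH[of "- x"] True by simp
    next
      case False
      then show ?thesis
        unfolding ws_word_Suc evalD_append comp_apply w set using IH[of x] IH[of "- x"] by simp
    qed
  qed
  then show "\<bar>x\<bar> = 1 \<Longrightarrow> \<bar>evalD (ws_word u L) x\<bar> = 1"
    and "2 \<le> \<bar>x\<bar> \<Longrightarrow> evalD (ws_word u L) x = (if \<exists>j\<in>{1..u}. \<bar>x\<bar> = int (L j) + 1 then - x else x)"
    by auto
qed

text \<open>The sign of the first value is irrelevant. Negating the second value \<open>b\<close>
  turns weight 0 into 2 if \<open>a < b\<close>, and leaves weight 1 if
  \<open>b < a\<close>.\<close>

lemma pairwt_ws_word:
  assumes "inj_on L {1..u}" "\<And>j. 1 \<le> j \<Longrightarrow> j \<le> u \<Longrightarrow> 1 \<le> L j" "1 \<le> a" "1 \<le> b" "a \<noteq> b"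
  shows "pairwt (evalD (ws_word u L) a) (evalD (ws_word u L) b)
    = pairwt a b + 2 * of_bool (a < b \<and> (\<exists>j\<in>{1..u}. b = int (L j) + 1))"
proof -
  note W = evalD_ws_word[OF assms(1,2)]
  have "evalD (ws_word u L) a = a \<or> evalD (ws_word u L) a = - a"
    using W[of a] assms(3) by (cases "a = 1") (auto split: if_splits)
  then have "pairwt (evalD (ws_word u L) a) y = pairwt a y" for y by auto
  moreover have "pairwt a (evalD (ws_word u L) b)
    = pairwt a b + 2 * of_bool (a < b \<and> (\<exists>j\<in>{1..u}. b = int (L j) + 1))"
  \<comment> \<open>The sign of the image of 1 is unknown here, but \<open>a\<close> is at least 2,
    so the weight is 1 for either sign.\<close>
  proof (cases "b = 1")
    case True
    then show ?thesis using W(1)[of b] assms by (auto simp: pairwt_def)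
  next
    case False
    then show ?thesis using W(2)[of b] assms by (auto simp: pairwt_def)
  qed
  ultimately show ?thesis by simp
qed

lemma dinv_ws_word:
  assumes "inj_on L {1..u}" "\<And>j. 1 \<le> j \<Longrightarrow> j \<le> u \<Longrightarrow> 1 \<le> L j"
    and "inj p" "\<And>x. 1 \<le> x \<Longrightarrow> 1 \<le> p x"
  shows "dinv n (evalD (ws_word u L) \<circ> p)
    = dinv n p + 2 * (\<Sum>t=1..u. int (card {(x, y) \<in> pairs n. p x < p y \<and> p y = int (L t) + 1}))"
proof -
  let ?C = "\<lambda>t. {(x, y) \<in> pairs n. p x < p y \<and> p y = int (L t) + 1}"
  let ?Q = "\<lambda>x y. p x < p y \<and> (\<exists>j\<in>{1..u}. p y = int (L j) + 1)"
  have "dinv n (evalD (ws_word u L) \<circ> p) = (\<Sum>(x, y)\<in>pairs n. pairwt (p x) (p y) + 2 * of_bool (?Q x y))"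
    unfolding dinv_def
  proof (rule sum.cong[OF refl], unfold split_paired_all prod.case comp_apply)
    fix x y assume xy: "(x, y) \<in> pairs n"
    then have "p x \<noteq> p y" using assms(3) by (auto simp: pairs_def dest: injD)
    then show "pairwt (evalD (ws_word u L) (p x)) (evalD (ws_word u L) (p y))
        = pairwt (p x) (p y) + 2 * of_bool (?Q x y)"
      using xy assms(4) by (intro pairwt_ws_word[OF assms(1,2)]) (auto simp: pairs_def)
  qed
  also have "\<dots> = dinv n p + 2 * (\<Sum>z\<in>pairs n. of_bool (?Q (fst z) (snd z)))"
    by (simp add: dinv_def sum.distrib sum_distrib_left case_prod_beta)
  also have "(\<Sum>z\<in>pairs n. of_bool (?Q (fst z) (snd z))) = int (card (pairs n \<inter> {z. ?Q (fst z) (snd z)}))"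
    by simp
  \<comment> \<open>The pairs that gain weight are sorted by the index \<open>t\<close> with larger
    value L_t + 1; distinct L_t make these classes disjoint.\<close>
  also have "pairs n \<inter> {z. ?Q (fst z) (snd z)} = (\<Union>t\<in>{1..u}. ?C t)"
    by auto
  also have "card \<dots> = (\<Sum>t=1..u. card (?C t))"
  proof (rule card_UN_disjoint)
    show "\<forall>t\<in>{1..u}. finite (?C t)" by (intro ballI finite_subset[OF _ finite_pairs[of n]]) auto
    show "\<forall>s\<in>{1..u}. \<forall>t\<in>{1..u}. s \<noteq> t \<longrightarrow> ?C s \<inter> ?C t = {}"
    proof (intro ballI impI)
      fix s t assume "s \<in> {1..u}" "t \<in> {1..u}" "s \<noteq> t"
      then have "L s \<noteq> L t" using assms(1) by (simp add: inj_on_eq_iff)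
      then show "?C s \<inter> ?C t = {}" by auto
    qed
  qed simp
  finally show ?thesis by (simp add: comp_def)
qed

section \<open>From positions to values\<close>

lemma evalS_range:
  assumes "set ws \<subseteq> {1..<n}" "1 \<le> x" "x \<le> n"
  shows "1 \<le> evalS ws x \<and> evalS ws x \<le> n"
  using assms by (induction ws) (auto simp: sS_def)

text \<open>A pair of positions is replaced by its pair of values. This turns the count into one
  about the inverse of \<open>w\<close>, for which explicit formulas follow.\<close>

lemma card_pairs_evalD:
  assumes w: "set w \<subseteq> {1..<n}" and b: "1 \<le> b" "b \<le> n"
  shows "card {(x, y) \<in> pairs n. evalD w x < evalD w y \<and> evalD w y = int b}
    = card {a \<in> {1..<b}. evalS (rev w) a < evalS (rev w) b}"
proof -
  let ?q = "evalS (rev w)"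
  have w': "set w \<subseteq> {1..}" "set (rev w) \<subseteq> {1..<n}" using w by auto
  note int = evalD_int[OF w'(1)]
  have pos: "\<exists>x'. x = int x' \<and> evalD w x = int (evalS w x')" if "1 \<le> x" for x
    using int[of "nat x"] that by (intro exI[of _ "nat x"]) simp
  have "bij_betw (\<lambda>a. (int (?q a), int (?q b))) {a \<in> {1..<b}. ?q a < ?q b}
      {(x, y) \<in> pairs n. evalD w x < evalD w y \<and> evalD w y = int b}"
  proof (rule bij_betw_byWitness[of _ "\<lambda>(x, y). nat (evalD w x)"])
    show "\<forall>z\<in>{(x, y) \<in> pairs n. evalD w x < evalD w y \<and> evalD w y = int b}.
        (int (?q (case z of (x, y) \<Rightarrow> nat (evalD w x))), int (?q b)) = z"
    proof clarify
      fix x y assume xy: "(x, y) \<in> pairs n" "evalD w y = int b"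
      obtain x' y' where "x = int x'" "evalD w x = int (evalS w x')" "y = int y'" "evalD w y = int (evalS w y')"
        using pos[of x] pos[of y] xy by (auto simp: pairs_def)
      then show "int (?q (nat (evalD w x))) = x \<and> int (?q b) = y" using xy
        by (metis evalS_rev nat_int of_nat_eq_iff)
    qed
    show "(\<lambda>a. (int (?q a), int (?q b))) ` {a \<in> {1..<b}. ?q a < ?q b}
        \<subseteq> {(x, y) \<in> pairs n. evalD w x < evalD w y \<and> evalD w y = int b}"
      using b evalS_range[OF w'(2)] by (fastforce simp: pairs_def int)
    show "(\<lambda>(x, y). nat (evalD w x)) ` {(x, y) \<in> pairs n. evalD w x < evalD w y \<and> evalD w y = int b}
        \<subseteq> {a \<in> {1..<b}. ?q a < ?q b}"
    proof clarify
      fix x y assume xy: "(x, y) \<in> pairs n" "evalD w x < evalD w y" "evalD w y = int b"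
      obtain x' y' where x': "x = int x'" "evalD w x = int (evalS w x')"
          "y = int y'" "evalD w y = int (evalS w y')"
        using pos[of x] pos[of y] xy by (auto simp: pairs_def)
      then have "b = evalS w y'" "x' < y'" "1 \<le> x'" "x' \<le> n" using xy by (auto simp: pairs_def)
      then show "nat (evalD w x) \<in> {1..<b} \<and> ?q (nat (evalD w x)) < ?q b"
        using x' xy(2) evalS_range[OF w, of x'] by simp
    qed
  qed (auto simp: int)
  then show ?thesis by (simp add: bij_betw_same_card)
qed

section \<open>The inverse of an elementary element\<close>

lemma evalS_rev_t_word:
  "1 \<le> k \<Longrightarrow> 1 \<le> x \<Longrightarrow> evalS (rev (t_word k)) x = (if k < x then x else if x = 1 then k else x - 1)"
proof (induction k rule: nat_induct_at_least)
  case (Suc k)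
  then have "t_word (Suc k) = t_word k @ [k]" by (simp add: t_word_def)
  with Suc show ?case by (auto simp: sS_def)
qed (auto simp: t_word_def)

lemma evalS_rev_t_word_power:
  assumes "1 \<le> k" "e \<le> k" "1 \<le> x"
  shows "evalS (rev (concat (replicate e (t_word k)))) x
    = (if k < x then x else if x \<le> e then x + k - e else x - e)"
  using assms(2)
proof (induction e)
  case (Suc e)
  \<comment> \<open>The new copy is split off on the right, because after \<open>rev\<close> the
    rightmost copy acts last.\<close>
  have "concat (replicate (Suc e) (t_word k)) = concat (replicate e (t_word k)) @ t_word k"
    by (metis concat_append concat.simps append_Nil2 replicate_Suc replicate_append_same)
  with Suc assms show ?case by (auto simp: evalS_rev_t_word)
qed (use assms in auto)

lemma elem_word_Suc:
  "elem_word (Suc m) k i = elem_word m k i @ concat (replicate (i (Suc m)) (t_word (k (Suc m))))"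
  by (simp add: elem_word_def)

text \<open>The total shift that the inverse applies to a point \<open>b\<close> above M: only the
  rotations of {1..k_x} that contain \<open>b\<close> count. For \<open>b = L + 1\<close> the
  condition reads L < k_x, which gives the sum subtracted in \<open>rho\<close> without the index
  q.\<close>

definition drop_sum :: "nat \<Rightarrow> (nat \<Rightarrow> nat) \<Rightarrow> (nat \<Rightarrow> nat) \<Rightarrow> nat \<Rightarrow> nat" where
  "drop_sum m k i b = (\<Sum>x=1..m. if b \<le> k x then i x else 0)"

lemma drop_sum_Suc: "drop_sum (Suc m) k i b = drop_sum m k i b + (if b \<le> k (Suc m) then i (Suc m) else 0)"
  by (simp add: drop_sum_def)

lemma drop_sum_le: "drop_sum m k i b \<le> (\<Sum>x=1..m. i x)"
  unfolding drop_sum_def by (rule sum_mono) auto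

context
  fixes m :: nat and k i :: "nat \<Rightarrow> nat"
  assumes k1: "2 \<le> k 1"
    and k_less: "\<And>x y. 1 \<le> x \<Longrightarrow> x < y \<Longrightarrow> y \<le> m \<Longrightarrow> k x < k y"
    and i: "\<And>j. 1 \<le> j \<Longrightarrow> j \<le> m \<Longrightarrow> 1 \<le> i j \<and> i j \<le> k j - 1"
    and M: "(\<Sum>j=1..m. i j) \<le> k 1"
begin

lemma k_mono: "1 \<le> x \<Longrightarrow> x \<le> y \<Longrightarrow> y \<le> m \<Longrightarrow> k x \<le> k y"
  using k_less[of x y] by (cases "x = y") auto

lemma partial_sum_mono: "r \<le> s \<Longrightarrow> (\<Sum>x=1..r. i x) \<le> (\<Sum>x=1..s. i x)"
  by (rule sum_mono2) auto

text \<open>The inverse rotations act in the order of increasing k_x. Those with k_x < b come first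
  and fix \<open>b\<close>; each later one lowers the point by i_x, and it never wraps around
  because \<open>b\<close> exceeds the sum of all exponents.\<close>

lemma evalS_rev_elem_word_large:
  assumes "l \<le> m" "(\<Sum>x=1..l. i x) < b"
  shows "evalS (rev (elem_word l k i)) b + drop_sum l k i b = b"
  using assms
proof (induction l)
  case 0
  then show ?case by (simp add: elem_word_def drop_sum_def)
next
  case (Suc l)
  let ?y = "evalS (rev (elem_word l k i)) b"
  have IH: "?y + drop_sum l k i b = b" using Suc by simp
  have dl: "drop_sum l k i b \<le> (\<Sum>x=1..l. i x)" by (rule drop_sum_le)
  have kl: "1 \<le> k (Suc l)" "i (Suc l) \<le> k (Suc l)"
    using i[of "Suc l"] k_mono[of 1 "Suc l"] k1 Suc.prems by auto
  have y: "1 \<le> ?y" using IH dl Suc.prems by simp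
  note rot = evalS_rev_t_word_power[OF kl y]
  show ?case
  proof (cases "b \<le> k (Suc l)")
    case True
    then have "?y \<le> k (Suc l)" "i (Suc l) < ?y" using IH dl Suc.prems by auto
    then show ?thesis using rot IH True by (simp add: elem_word_Suc drop_sum_Suc)
  next
    case False
    have "drop_sum l k i b = 0"
      unfolding drop_sum_def using k_mono[of _ "Suc l"] Suc.prems False by (intro sum.neutral) force
    then show ?thesis using rot IH False by (simp add: elem_word_Suc drop_sum_Suc)
  qed
qed

text \<open>A point in block \<open>r\<close> is lowered by the first r - 1 rotations, wraps around
  the top of {1..k_r} in the r-th, and is lowered again by the later ones.\<close>

lemma evalS_rev_elem_word_small:
  assumes "l \<le> m" "1 \<le> r" "r \<le> l" "(\<Sum>x=1..r-1. i x) < b" "b \<le> (\<Sum>x=1..r. i x)"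
  shows "evalS (rev (elem_word l k i)) b + (\<Sum>x=1..l. i x) = b + k r"
  using assms(1,3)
proof (induction l)
  case 0
  then show ?case using assms(2) by simp
next
  case (Suc l)
  let ?y = "evalS (rev (elem_word l k i)) b"
  have kl: "1 \<le> k (Suc l)" "i (Suc l) \<le> k (Suc l)"
    using i[of "Suc l"] k_mono[of 1 "Suc l"] k1 Suc.prems by auto
  have Sl: "(\<Sum>x=1..Suc l. i x) \<le> k 1" using partial_sum_mono[of "Suc l" m] M Suc.prems by simp
  show ?case
  proof (cases "r = Suc l")
    case False
    then have IH: "?y + (\<Sum>x=1..l. i x) = b + k r" using Suc by simp
    have "b \<le> (\<Sum>x=1..l. i x)" using partial_sum_mono[of r l] assms False Suc.prems by simp
    moreover have "k 1 \<le> k r" "k r \<le> k (Suc l)"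
      using k_mono[of 1 r] k_mono[of r "Suc l"] assms Suc.prems by auto
    \<comment> \<open>There is no second wrap: the exponents sum to at most k_1, hence to at most
      k_r.\<close>
    ultimately have y: "i (Suc l) < ?y" "?y \<le> k (Suc l)" using IH Sl assms(4) by auto
    then have "1 \<le> ?y" by simp
    from evalS_rev_t_word_power[OF kl this] y IH show ?thesis by (simp add: elem_word_Suc)
  next
    case True
    then have b: "(\<Sum>x=1..l. i x) < b" "b \<le> (\<Sum>x=1..Suc l. i x)" using assms by auto
    have "b \<le> k x" if "1 \<le> x" "x \<le> l" for x
      using k_mono[of 1 x] b Sl that Suc.prems by auto
    then have "drop_sum l k i b = (\<Sum>x=1..l. i x)" unfolding drop_sum_def by (intro sum.cong) auto
    with evalS_rev_elem_word_large[of l b] b Suc.prems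
    have IH: "?y + (\<Sum>x=1..l. i x) = b" by simp
    then have y: "1 \<le> ?y" "?y \<le> i (Suc l)" using b by auto
    from evalS_rev_t_word_power[OF kl y(1)] y IH kl True show ?thesis by (simp add: elem_word_Suc)
  qed
qed

section \<open>Order of the values of the inverse\<close>

lemma block_exists:
  assumes "1 \<le> b" "b \<le> (\<Sum>x=1..m. i x)"
  obtains r where "1 \<le> r" "r \<le> m" "(\<Sum>x=1..r-1. i x) < b" "b \<le> (\<Sum>x=1..r. i x)"
proof -
  define r where "r = (LEAST r. b \<le> (\<Sum>x=1..r. i x))"
  have le: "b \<le> (\<Sum>x=1..r. i x)" unfolding r_def by (rule LeastI[of _ m]) (use assms in simp)
  have "r \<le> m" unfolding r_def by (rule Least_le) (use assms in simp)
  moreover have "r \<noteq> 0" using le assms by (intro notI) simp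
  moreover from this have "\<not> b \<le> (\<Sum>x=1..r-1. i x)" unfolding r_def by (intro not_less_Least) simp
  ultimately show ?thesis using le that[of r] by simp
qed

text \<open>On {1..M} the inverse adds k_r - M to a point of block \<open>r\<close>, and k_r grows
  weakly with the point.\<close>

lemma evalS_rev_elem_word_mono_small:
  assumes a: "1 \<le> a" and ab: "a < b" and b: "b \<le> (\<Sum>x=1..m. i x)"
  shows "evalS (rev (elem_word m k i)) a < evalS (rev (elem_word m k i)) b"
proof -
  obtain r where r: "1 \<le> r" "r \<le> m" "(\<Sum>x=1..r-1. i x) < a" "a \<le> (\<Sum>x=1..r. i x)"
    using block_exists[of a] assms by auto
  obtain s where s: "1 \<le> s" "s \<le> m" "(\<Sum>x=1..s-1. i x) < b" "b \<le> (\<Sum>x=1..s. i x)"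
    using block_exists[of b] assms by auto
  have "r \<le> s"
  proof (rule ccontr)
    assume "\<not> r \<le> s"
    then have "s \<le> r - 1" by simp
    from partial_sum_mono[OF this] show False using r s ab by simp
  qed
  then have "k r \<le> k s" using k_mono r s by simp
  with evalS_rev_elem_word_small[OF order_refl r] evalS_rev_elem_word_small[OF order_refl s] ab
  show ?thesis by simp
qed

text \<open>Let \<open>a\<close> lie in block \<open>r\<close>. If k_r < b, then
  \<open>drop_sum\<close> involves only indices after \<open>r\<close>, and both sides hold.
  Otherwise it contains all exponents from \<open>r\<close> on, and both sides fail.\<close>

lemma evalS_rev_elem_word_less_iff_mixed:
  assumes a: "1 \<le> a" "a \<le> (\<Sum>x=1..m. i x)" and b: "(\<Sum>x=1..m. i x) < b"
  shows "evalS (rev (elem_word m k i)) a < evalS (rev (elem_word m k i)) b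
    \<longleftrightarrow> a + drop_sum m k i b \<le> (\<Sum>x=1..m. i x)"
proof -
  obtain r where r: "1 \<le> r" "r \<le> m" "(\<Sum>x=1..r-1. i x) < a" "a \<le> (\<Sum>x=1..r. i x)"
    using block_exists[of a] assms by auto
  have qa: "evalS (rev (elem_word m k i)) a + (\<Sum>x=1..m. i x) = a + k r"
    by (rule evalS_rev_elem_word_small[OF order_refl r])
  have qb: "evalS (rev (elem_word m k i)) b + drop_sum m k i b = b"
    by (rule evalS_rev_elem_word_large[OF order_refl b])
  have split: "(\<Sum>x=1..m. f x) = (\<Sum>x=1..l. f x) + (\<Sum>x=Suc l..m. f x)" if "l \<le> m" for f :: "nat \<Rightarrow> nat" and l
    using that by (metis sum.ub_add_nat le_add_diff_inverse Suc_eq_plus1 add.commute le_add1)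
  show ?thesis
  proof (cases "k r < b")
    case True
    have "(\<Sum>x=1..r. if b \<le> k x then i x else 0) = 0"
      using k_mono[of _ r] r True by (intro sum.neutral) force
    moreover have "(\<Sum>x=Suc r..m. if b \<le> k x then i x else 0) \<le> (\<Sum>x=Suc r..m. i x)"
      by (rule sum_mono) auto
    ultimately have "(\<Sum>x=1..r. i x) + drop_sum m k i b \<le> (\<Sum>x=1..m. i x)"
      unfolding drop_sum_def using split[OF r(2)] by simp
    then show ?thesis using qa qb r True by linarith
  next
    case False
    have "b \<le> k x" if "r \<le> x" "x \<le> m" for x using k_mono[of r x] r that False by simp
    then have "(\<Sum>x=Suc (r-1)..m. if b \<le> k x then i x else 0) = (\<Sum>x=Suc (r-1)..m. i x)"
      by (intro sum.cong) auto
    then have "(\<Sum>x=1..m. i x) \<le> (\<Sum>x=1..r-1. i x) + drop_sum m k i b"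
      unfolding drop_sum_def using split[of "r - 1"] r by simp
    then show ?thesis using qa qb r False by linarith
  qed
qed

lemma evalS_rev_elem_word_mono_large:
  assumes a: "(\<Sum>x=1..m. i x) < a" and ab: "a < b"
  shows "evalS (rev (elem_word m k i)) a < evalS (rev (elem_word m k i)) b"
proof -
  have "drop_sum m k i b \<le> drop_sum m k i a"
    unfolding drop_sum_def by (rule sum_mono) (use ab in auto)
  then show ?thesis
    using evalS_rev_elem_word_large[OF order_refl, of a] evalS_rev_elem_word_large[OF order_refl, of b] assms
    by linarith
qed

text \<open>From M on, the cases of \<open>rho\<close> agree: as \<open>k\<close> increases, the
  indices with L < k_x form a final segment, which is empty, everything, or q..m.\<close>

lemma rho_eq_drop_sum:
  assumes m: "1 \<le> m" and x: "(\<Sum>j=1..m. i j) \<le> x"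
  shows "rho m k i x = int x - int (drop_sum m k i (Suc x))"
proof -
  consider "k m \<le> x" | "x < k 1" "x < k m" | "k 1 \<le> x" "x < k m" by linarith
  then show ?thesis
  proof cases
    case 1
    then have "drop_sum m k i (Suc x) = 0"
      unfolding drop_sum_def using k_mono[of _ m] by (intro sum.neutral) force
    then show ?thesis using 1 by (simp add: rho_def)
  next
    case 2
    then have "drop_sum m k i (Suc x) = (\<Sum>j=1..m. i j)"
      unfolding drop_sum_def using k_mono[of 1] by (intro sum.cong) force+
    then show ?thesis using 2 x by (simp add: rho_def)
  next
    case 3
    \<comment> \<open>The least index with x < k_q is the one selected by the definite description
      in \<open>rho\<close>.\<close>
    define q where "q = (LEAST q. 1 \<le> q \<and> x < k q)"
    have q: "1 \<le> q \<and> x < k q" unfolding q_def by (rule LeastI[of _ m]) (use m 3 in simp)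
    have "q \<le> m" unfolding q_def by (rule Least_le) (use m 3 in simp)
    have "q \<noteq> 1" using q 3 by auto
    have below: "k y \<le> x" if "1 \<le> y" "y < q" for y
      using not_less_Least[of y "\<lambda>q. 1 \<le> q \<and> x < k q"] that by (simp add: q_def)
    have "(THE q. 2 \<le> q \<and> q \<le> m \<and> k (q - 1) \<le> x \<and> x < k q) = q"
    proof (rule the_equality)
      show "2 \<le> q \<and> q \<le> m \<and> k (q - 1) \<le> x \<and> x < k q"
        using q \<open>q \<le> m\<close> \<open>q \<noteq> 1\<close> below[of "q - 1"] by auto
    next
      fix s assume s: "2 \<le> s \<and> s \<le> m \<and> k (s - 1) \<le> x \<and> x < k s"
      have "\<not> s < q" using below[of s] s by auto
      moreover have "\<not> q < s" 
      proof
        assume "q < s"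
        then have "q \<le> s - 1" "s - 1 \<le> m" using s by linarith+
        then show False using k_mono[of q "s - 1"] q s by linarith
      qed
      ultimately show "s = q" by simp
    qed
    moreover have "drop_sum m k i (Suc x) = (\<Sum>y=q..m. i y)"
    proof -
      have "Suc x \<le> k y \<longleftrightarrow> q \<le> y" if "1 \<le> y" "y \<le> m" for y
        using below[of y] k_mono[of q y] q that by (cases "q \<le> y") auto
      then have "drop_sum m k i (Suc x) = (\<Sum>y=1..m. if q \<le> y then i y else 0)"
        unfolding drop_sum_def by (intro sum.cong) auto
      also have "\<dots> = (\<Sum>y\<in>{1..m} \<inter> {y. q \<le> y}. i y)" by (simp add: sum.inter_restrict)
      also have "{1..m} \<inter> {y. q \<le> y} = {q..m}" using q by auto
      finally show ?thesis .
    qed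
    ultimately show ?thesis using 3 x by (simp add: rho_def)
  qed
qed

text \<open>Below M every smaller value counts. Otherwise M - d of the values up to M count, where d
  is the \<open>drop_sum\<close>, together with all x - M values above M, which makes x - d.\<close>

lemma card_non_inversions_elem_word:
  assumes m: "1 \<le> m"
  shows "int (card {a \<in> {1..<Suc x}. evalS (rev (elem_word m k i)) a < evalS (rev (elem_word m k i)) (Suc x)})
    = rho m k i x" (is "int (card ?A) = _")
proof (cases "x < (\<Sum>j=1..m. i j)")
  case True
  then have "?A = {1..<Suc x}" using evalS_rev_elem_word_mono_small by auto
  then show ?thesis using True by (simp add: rho_def)
next
  case False
  let ?M = "\<Sum>j=1..m. i j"
  have d: "drop_sum m k i (Suc x) \<le> ?M" by (rule drop_sum_le)
  have "?A = {1..?M - drop_sum m k i (Suc x)} \<union> {Suc ?M..x}"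
  proof (intro set_eqI)
    fix a
    show "a \<in> ?A \<longleftrightarrow> a \<in> {1..?M - drop_sum m k i (Suc x)} \<union> {Suc ?M..x}"
      using evalS_rev_elem_word_mono_large[of a "Suc x"]
        evalS_rev_elem_word_less_iff_mixed[of a "Suc x"] d False
      by (cases "a \<le> ?M") auto
  qed
  then have "card ?A = ?M - drop_sum m k i (Suc x) + (x - ?M)"
    by (simp only:) (subst card_Un_disjoint, auto)
  then show ?thesis using rho_eq_drop_sum[OF m] False d by simp
qed

end

section \<open>The length formula\<close>

theorem mainTheorem15:
  fixes n m u :: nat and k i L :: "nat \<Rightarrow> nat"
  assumes "m \<ge> 1"
    and "2 \<le> k 1"
    and "\<And>j. 1 \<le> j \<Longrightarrow> j < m \<Longrightarrow> k j < k (j + 1)"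
    and "k m \<le> n"
    and "\<And>j. 1 \<le> j \<Longrightarrow> j \<le> m \<Longrightarrow> 1 \<le> i j \<and> i j \<le> k j - 1"
    and "(\<Sum>j=1..m. i j) \<le> k 1"
    and "inj_on L {1..u}"
    and "\<And>j. 1 \<le> j \<Longrightarrow> j \<le> u \<Longrightarrow> 1 \<le> L j \<and> L j \<le> n - 1"
  shows "int (lenD n (evalD (ws_word u L @ elem_word m k i)))
           = int (lenS n (evalS (elem_word m k i))) + 2 * (\<Sum>j=1..u. rho m k i (L j))"
proof -
  let ?w = "elem_word m k i"
  \<comment> \<open>The hypothesis compares only neighbouring k_j; the lemmas on the inverse use
    arbitrary pairs of indices.\<close>
  have k_less: "k x < k y" if "1 \<le> x" "x < y" "y \<le> m" for x y
    using that(2,3)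
  proof (induction y rule: less_induct)
    case (less y)
    then have "k (y - 1) < k y" using assms(3)[of "y - 1"] that(1) by simp
    moreover have "k x \<le> k (y - 1)" using less.IH[of "y - 1"] less.prems
      by (cases "x = y - 1") (auto intro: less_imp_le)
    ultimately show ?case by simp
  qed
  have kn: "k j \<le> n" if "1 \<le> j" "j \<le> m" for j
    using k_less[of j m] that assms(4) by (cases "j = m") auto
  have n: "2 \<le> n" using kn[of 1] assms(1,2) by simp
  have w: "set ?w \<subseteq> {1..<n}" using kn by (force simp: elem_word_def t_word_def)
  then have w': "set ?w \<subseteq> {..<n}" by auto
  have ws: "set (ws_word u L) \<subseteq> {..<n}"
  proof
    fix a assume "a \<in> set (ws_word u L)"
    then obtain j where j: "1 \<le> j" "j \<le> u" "a \<in> set (w_word (L j))" by (auto simp: ws_word_def)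
    then have "a \<le> L j" by (auto simp: w_word_def)
    then show "a \<in> {..<n}" using assms(8)[of j] j n by auto
  qed
  have "signed_perm n (evalD ?w)" using w' n by (rule signed_perm_evalD)
  then have inj: "inj (evalD ?w)" by (simp add: signed_perm_def)
  have w1: "set ?w \<subseteq> {1..}" using w by auto
  \<comment> \<open>The weight change under sign changes was computed for positive values
    only.\<close>
  have pos: "1 \<le> evalD ?w x" if "1 \<le> x" for x
  proof -
    have "0 \<le> evalD ?w x" using evalD_int[OF w1, of "nat x"] that by simp
    moreover have "evalD ?w x \<noteq> 0"
      using signed_perm_eq_0_iff[OF \<open>signed_perm n (evalD ?w)\<close>] that by simp
    ultimately show ?thesis by simp
  qed
  have card: "int (card {(x, y) \<in> pairs n. evalD ?w x < evalD ?w y \<and> evalD ?w y = int (L t) + 1})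
      = rho m k i (L t)" if t: "t \<in> {1..u}" for t
  proof -
    have "Suc (L t) \<le> n" using assms(8)[of t] t n by auto
    then show ?thesis
      using card_pairs_evalD[OF w, of "Suc (L t)"]
        card_non_inversions_elem_word[OF assms(2) k_less assms(5,6,1), of "L t"]
      by (simp add: add.commute)
  qed
  have "int (lenD n (evalD (ws_word u L @ ?w))) = dinv n (evalD (ws_word u L) \<circ> evalD ?w)"
    using lenD_evalD[of "ws_word u L @ ?w" n] ws w' n by simp
  also have "\<dots> = dinv n (evalD ?w) + 2 * (\<Sum>t=1..u. rho m k i (L t))"
    using dinv_ws_word[OF assms(7) _ inj pos, of n] assms(8) card by simp
  finally show ?thesis by (simp add: lenS_evalS[OF w n])
qed

end
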